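(* Let $K\ge 1$ and $T\ge 1$ be integers. Then there exists a finite set $F\subset(0.5,1)$ such that for every real $\alpha\in(0.5,1)\setminus F$, the fixed-size ordinally-forgetting encoding (FOFE) with forgetting factor $\alpha$ is unique for vocabulary size $K$ and length bound $T$; that is, if $S$ and $S'$ are two sequences of symbols from a vocabulary of $K$ symbols, each of length between $1$ and $T$, and $S$ and $S'$ have the same FOFE code in $\mathbb{R}^K$, then $S=S'$ (in particular they have the same length).
   Context: Fix a vocabulary of $K$ symbols, identified with $\{1,\dots,K\}$; the symbol $k$ is represented by the one-hot vector in $\mathbb{R}^K$ whose $k$-th entry is $1$ and whose other entries are $0$. Fix a real constant $\alpha$ with $0<\alpha<1$ (the forgetting factor). For a finite sequence $S=(w_1,\dots,w_n)$ of vocabulary symbols, let $\mathbf{e}_t\in\mathbb{R}^K$ be the one-hot vector of $w_t$, and define recursively $\mathbf{z}_0=\mathbf{0}$ and $\mathbf{z}_t=\alpha\,\mathbf{z}_{t-1}+\mathbf{e}_t$ for $1\le t\le n$. The FOFE code of $S$ is $\mathbf{z}_n=\sum_{t=1}^{n}\alpha^{n-t}\mathbf{e}_t\in\mathbb{R}^K$. FOFE (with factor $\alpha$) is called unique for $K$ and $T$ if every sequence $S$ of length at most $T$ over the vocabulary can be recovered unambiguously from its FOFE code, i.e. the map sending a sequence of length between $1$ and $T$ to its FOFE code is injective. *)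

theory Defs
  imports "HOL-Analysis.Analysis"
begin

text \<open>
  The vocabulary of \<open>K\<close> symbols is a finite type \<open>'k\<close> with \<open>K = CARD('k)\<close>, which is automatically
  at least 1. The one-hot vector of a symbol \<open>w\<close> is \<open>axis w 1 :: real ^ 'k\<close>.
  Lists are indexed from 0, so the symbol \<open>w\<^sub>t\<close> of a sequence \<open>S\<close> is \<open>S ! (t - 1)\<close>.
\<close>

fun fofe_state :: "real \<Rightarrow> 'k::finite list \<Rightarrow> nat \<Rightarrow> real ^ 'k" where
  "fofe_state \<alpha> S 0 = 0"
| "fofe_state \<alpha> S (Suc t) = \<alpha> *\<^sub>R fofe_state \<alpha> S t + axis (S ! t) 1"

definition fofe :: "real \<Rightarrow> 'k::finite list \<Rightarrow> real ^ 'k" where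
  "fofe \<alpha> S = fofe_state \<alpha> S (length S)"

lemma fofe_state_closed_form:
  "fofe_state \<alpha> S n = (\<Sum>t = 1..n. \<alpha> ^ (n - t) *\<^sub>R axis (S ! (t - 1)) 1)"
proof (induction n)
  case 0
  then show ?case by simp
next
  case (Suc n)
  have "\<alpha> *\<^sub>R fofe_state \<alpha> S n = (\<Sum>t = 1..n. \<alpha> ^ (Suc n - t) *\<^sub>R axis (S ! (t - 1)) 1)"
    unfolding Suc.IH scaleR_sum_right by (rule sum.cong) (auto simp: Suc_diff_le)
  then show ?case by simp
qed

corollary fofe_closed_form:
  "fofe \<alpha> S = (\<Sum>t = 1..length S. \<alpha> ^ (length S - t) *\<^sub>R axis (S ! (t - 1)) 1)"
  by (simp only: fofe_def fofe_state_closed_form)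

text \<open>The type argument carries the vocabulary, and with it its size \<open>K\<close>.\<close>

definition fofe_unique :: "'k::finite itself \<Rightarrow> nat \<Rightarrow> real \<Rightarrow> bool" where
  "fofe_unique _ T \<alpha> \<longleftrightarrow>
     inj_on (fofe \<alpha> :: 'k list \<Rightarrow> real ^ 'k) {S. 1 \<le> length S \<and> length S \<le> T}"

end

theory Submission
  imports Defs "HOL-Computational_Algebra.Polynomial"
begin

text \<open>
  Each coordinate of a FOFE code is a polynomial in \<open>\<alpha>\<close> with coefficients 0 and 1, whose
  coefficients record the positions, counted from the end, at which the symbol occurs. Two
  distinct sequences therefore differ in one of these polynomials, and their codes can collide
  only at the finitely many roots of the difference. There are only finitely many pairs of
  sequences of length at most \<open>T\<close>.
\<close>

definition fofe_poly :: "'k \<Rightarrow> 'k list \<Rightarrow> real poly" where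
  "fofe_poly k S = Poly (map (\<lambda>w. of_bool (w = k)) (rev S))"

lemma fofe_state_append:
  "n \<le> length S \<Longrightarrow> fofe_state \<alpha> (S @ R) n = fofe_state \<alpha> S n"
  by (induction n) (auto simp: nth_append)

lemma fofe_snoc: "fofe \<alpha> (S @ [w]) = \<alpha> *\<^sub>R fofe \<alpha> S + axis w 1"
  by (simp add: fofe_def fofe_state_append)

text \<open>Appending a symbol is one Horner step: \<open>rev\<close> turns the appended symbol into
  the constant coefficient and shifts the others up by one degree.\<close>

lemma fofe_nth_eq_poly: "fofe \<alpha> S $ k = poly (fofe_poly k S) \<alpha>"
proof (induction S rule: rev_induct)
  case Nil
  then show ?case by (simp add: fofe_def fofe_poly_def)
next
  case (snoc w S)
  then show ?case by (simp add: fofe_snoc fofe_poly_def axis_def)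
qed

lemma coeff_fofe_poly:
  "coeff (fofe_poly k S) i = of_bool (i < length S \<and> rev S ! i = k)"
  by (auto simp: fofe_poly_def nth_default_def)

text \<open>One polynomial may miss the length, since its top coefficients can vanish; but each
  position below the length carries some symbol, so all \<open>k\<close> together reveal it.\<close>

lemma fofe_poly_inject:
  assumes "\<And>k. fofe_poly k S = fofe_poly k S'"
  shows "S = S'"
proof -
  have *: "i < length S \<and> rev S ! i = k \<longleftrightarrow> i < length S' \<and> rev S' ! i = k" for i k
    using arg_cong[OF assms[of k], of "\<lambda>p. coeff p i"] by (simp add: coeff_fofe_poly of_bool_eq_iff)
  then have "i < length S \<longleftrightarrow> i < length S'" for i
    by blast
  then have "length S = length S'"
    by (metis linorder_neqE_nat less_irrefl)
  with * have "rev S = rev S'"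
    by (intro nth_equalityI) auto
  then show ?thesis by simp
qed

lemma finite_fofe_collisions:
  fixes S S' :: "'k::finite list"
  assumes "S \<noteq> S'"
  shows "finite {\<alpha>. fofe \<alpha> S = fofe \<alpha> S'}"
proof -
  obtain k where "fofe_poly k S - fofe_poly k S' \<noteq> 0"
    using assms fofe_poly_inject by (metis right_minus_eq)
  then have "finite {\<alpha>. poly (fofe_poly k S - fofe_poly k S') \<alpha> = 0}"
    by (rule poly_roots_finite)
  \<comment> \<open>A collision equates all coordinates, so it is a root for this particular
    \<open>k\<close>.\<close>
  then show ?thesis
    by (rule rev_finite_subset) (auto simp flip: fofe_nth_eq_poly)
qed

theorem theorem2:
  fixes T :: nat
  assumes "T \<ge> 1"
  shows "\<exists>F :: real set. finite F \<and> F \<subseteq> {1/2<..<1} \<and>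
           (\<forall>\<alpha> \<in> {1/2<..<1} - F. fofe_unique TYPE('k::finite) T \<alpha>)"
proof -
  define L where "L = {S :: 'k list. length S \<le> T}"
  define F where
    "F = {1/2<..<1} \<inter> (\<Union>(S, S') \<in> {p \<in> L \<times> L. fst p \<noteq> snd p}. {\<alpha>. fofe \<alpha> S = fofe \<alpha> S'})"
  have "finite L"
    using finite_lists_length_le[of "UNIV :: 'k set" T] by (simp add: L_def)
  then have "finite F"
    unfolding F_def by (auto intro!: finite_Int finite_UN_I finite_fofe_collisions)
  moreover have "F \<subseteq> {1/2<..<1}"
    by (auto simp: F_def)
  moreover have "fofe_unique TYPE('k) T \<alpha>" if "\<alpha> \<in> {1/2<..<1} - F" for \<alpha>
    \<comment> \<open>As \<open>\<alpha>\<close> lies in the interval, avoiding \<open>F\<close>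
      means avoiding every collision set.\<close>
    using that unfolding fofe_unique_def by (auto simp: inj_on_def F_def L_def)
  ultimately show ?thesis by blast
qed

end
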